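(* Let $\mathfrak A\in \mathfrak M (2)$ and denote the associated spectrum by $\sigma(\mathfrak A)$. Then, for $k\in \mathbb N^*$, \begin{equation} \mathfrak m_k(2)= \Big \lfloor\frac{1}{2}\Big(1+\sqrt{8k-7}\Big)\Big\rfloor\,. \end{equation} where for $x\in \mathbb R^+$, $\lfloor x \rfloor$ denotes the integer part of $x$.
   Context: For $N\in\mathbb N^*=\mathbb N\setminus\{0\}$, let $\mathfrak M(N)$ be the family of arrays $\mathfrak A=(a^n_i)$ with $N$ rows, each row an infinite strictly increasing sequence of reals. The spectrum $\sigma(\mathfrak A)$ is the set of all sums $\lambda=\sum_{n=1}^N a^n_{j_n}$ with $(j_1,\dots,j_N)\in(\mathbb N^* )^N$, and the multiplicity of $\lambda$ is the number of such $N$-tuples representing it. Ordering the spectrum as a non-decreasing sequence $\lambda_1(\mathfrak A)\le\lambda_2(\mathfrak A)\le\dots$ counted with multiplicity, set $m(k,\mathfrak A)$ = multiplicity of $\lambda_k(\mathfrak A)$ and $\mathfrak m_k(N)=\sup_{\mathfrak A\in\mathfrak M(N)} m(k,\mathfrak A)$. Here $N=2$. *)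

theory Defs
  imports Complex_Main "HOL-Library.FuncSet" "HOL-Library.Extended_Nat"
begin

text \<open>Rows and columns are indexed from 1, so row \<open>n\<close> of \<open>a\<close> is \<open>a n 1, a n 2, \<dots>\<close>;
  values of \<open>a\<close> at other indices are irrelevant.\<close>

definition arrays :: "nat \<Rightarrow> (nat \<Rightarrow> nat \<Rightarrow> real) set" where
  "arrays N = {a. \<forall>n\<in>{1..N}. strict_mono_on {1..} (a n)}"

definition tuples :: "nat \<Rightarrow> (nat \<Rightarrow> nat) set" where
  "tuples N = {1..N} \<rightarrow>\<^sub>E {1..}"

definition tuple_sum :: "nat \<Rightarrow> (nat \<Rightarrow> nat \<Rightarrow> real) \<Rightarrow> (nat \<Rightarrow> nat) \<Rightarrow> real" where
  "tuple_sum N a j = (\<Sum>n=1..N. a n (j n))"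

definition spectrum :: "nat \<Rightarrow> (nat \<Rightarrow> nat \<Rightarrow> real) \<Rightarrow> real set" where
  "spectrum N a = tuple_sum N a ` tuples N"

text \<open>For \<open>a \<in> arrays N\<close> the tuples representing a given value form an antichain of
  \<open>(\<nat>\<^sup>*)\<^sup>N\<close>, so the set below is finite and \<open>card\<close> is the true number of tuples.\<close>

definition multiplicity_of :: "nat \<Rightarrow> (nat \<Rightarrow> nat \<Rightarrow> real) \<Rightarrow> real \<Rightarrow> nat" where
  "multiplicity_of N a x = card {j \<in> tuples N. tuple_sum N a j = x}"

text \<open>\<open>l 1 \<le> l 2 \<le> \<dots>\<close> lists the spectrum in non-decreasing order, each value repeated
  according to its multiplicity. Rows are not required to be unbounded, so the spectrum may
  have accumulation points; being well-ordered, it still has a first, second, \<dots> element, and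
  the last conjunct says that \<open>l\<close> skips nothing: a value that is not listed exceeds all
  listed ones. If all rows tend to infinity, every value is listed.\<close>

definition ordered_spectrum :: "nat \<Rightarrow> (nat \<Rightarrow> nat \<Rightarrow> real) \<Rightarrow> (nat \<Rightarrow> real) \<Rightarrow> bool" where
  "ordered_spectrum N a l \<longleftrightarrow>
     mono_on {1..} l \<and>
     (\<forall>k\<ge>1. l k \<in> spectrum N a \<and> card {i. i \<ge> 1 \<and> l i = l k} = multiplicity_of N a (l k)) \<and>
     (\<forall>x\<in>spectrum N a. (\<exists>k\<ge>1. l k = x) \<or> (\<forall>k\<ge>1. l k < x))"

definition eigenvalue :: "nat \<Rightarrow> (nat \<Rightarrow> nat \<Rightarrow> real) \<Rightarrow> nat \<Rightarrow> real" where
  "eigenvalue N a k = (THE x. \<exists>l. ordered_spectrum N a l \<and> l k = x)"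

definition mult_at :: "nat \<Rightarrow> nat \<Rightarrow> (nat \<Rightarrow> nat \<Rightarrow> real) \<Rightarrow> nat" where
  "mult_at N k a = multiplicity_of N a (eigenvalue N a k)"

text \<open>The supremum is taken in \<^typ>\<open>enat\<close>, so that a finite value entails boundedness.\<close>

definition max_mult :: "nat \<Rightarrow> nat \<Rightarrow> enat" where
  "max_mult N k = (SUP a\<in>arrays N. enat (mult_at N k a))"

end

theory Submission
  imports Defs
begin

text \<open>The \<open>k\<close>-th element \<open>x\<close> of the spectrum is characterised by the inequalities
  \<open>card {j. sum j < x} < k \<le> card {j. sum j \<le> x}\<close>. If \<open>m\<close> pairs represent \<open>x\<close>, then two
  of them, \<open>(p\<^sub>1, p\<^sub>2)\<close> and \<open>(q\<^sub>1, q\<^sub>2)\<close> with \<open>p\<^sub>1 < q\<^sub>1\<close>, give the pair \<open>(p\<^sub>1, q\<^sub>2)\<close>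
  of smaller sum. This assignment is injective, so \<open>m (m - 1) / 2 < k\<close>. The array with
  both rows \<open>1, 2, 3, \<dots>\<close> attains the largest such \<open>m\<close>.\<close>

section \<open>Dickson's lemma for sequences of tuples of naturals\<close>

text \<open>A non-increasing sequence of naturals is constant from the point where it reaches its
  least value, and that tail is \<open>incseq\<close>. So either kind of monotone subsequence
  suffices.\<close>

lemma nat_seq_incseq_subseq:
  fixes x :: "nat \<Rightarrow> nat"
  obtains r :: "nat \<Rightarrow> nat" where "strict_mono r" "incseq (x \<circ> r)"
proof -
  obtain r where r: "strict_mono r" "monoseq (\<lambda>n. x (r n))"
    using seq_monosub by blast
  show ?thesis
  proof (cases "incseq (\<lambda>n. x (r n))")
    case True
    then show ?thesis using that r by (simp add: comp_def)
  next
    case False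
    then have dec: "\<And>m n. m \<le> n \<Longrightarrow> x (r n) \<le> x (r m)"
      using r(2) by (auto simp: monoseq_def incseq_def)
    define y where "y = (LEAST y. \<exists>n. x (r n) = y)"
    have "\<exists>n. x (r n) = y" unfolding y_def by (rule LeastI_ex) blast
    then obtain n0 where n0: "x (r n0) = y" ..
    have "x (r (n0 + n)) = y" for n
      using dec[of n0 "n0 + n"] n0 Least_le[of "\<lambda>y. \<exists>n. x (r n) = y" "x (r (n0 + n))"]
      unfolding y_def by fastforce
    then have "incseq (x \<circ> (\<lambda>n. r (n0 + n)))"
      by (simp add: incseq_def)
    moreover have "strict_mono (\<lambda>n. r (n0 + n))"
      using r(1) by (simp add: strict_mono_def)
    ultimately show ?thesis using that by blast
  qed
qed

text \<open>Coordinates are treated one at a time: thinning the sequence further keeps those already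
  handled monotone.\<close>

lemma nat_tuple_seq_incseq_subseq:
  fixes s :: "nat \<Rightarrow> 'i \<Rightarrow> nat"
  assumes "finite F"
  shows "\<exists>r. strict_mono r \<and> (\<forall>i\<in>F. incseq (\<lambda>n. s (r n) i))"
  using assms
proof induction
  case empty
  show ?case by (auto intro: exI[of _ id] strict_mono_id)
next
  case (insert i F)
  then obtain r where r: "strict_mono r" "\<forall>i\<in>F. incseq (\<lambda>n. s (r n) i)" by blast
  obtain q where q: "strict_mono q" "incseq ((\<lambda>n. s (r n) i) \<circ> q)"
    using nat_seq_incseq_subseq .
  have "incseq (\<lambda>n. s (r (q n)) i')" if "i' \<in> F" for i'
    using r(2) that q(1) by (simp add: incseq_def strict_mono_less_eq)
  moreover have "strict_mono (\<lambda>n. r (q n))"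
    using strict_mono_o[OF r(1) q(1)] by (simp add: comp_def)
  ultimately show ?case
    using q(2) by (intro exI[of _ "\<lambda>n. r (q n)"]) (auto simp: comp_def)
qed

lemma nat_tuple_seq_le:
  fixes s :: "nat \<Rightarrow> 'i \<Rightarrow> nat"
  assumes "finite F"
  obtains m n where "m < n" "\<forall>i\<in>F. s m i \<le> s n i"
proof -
  obtain r where r: "strict_mono r" "\<forall>i\<in>F. incseq (\<lambda>n. s (r n) i)"
    using nat_tuple_seq_incseq_subseq[OF assms] by blast
  have "r 0 < r 1" using r(1) by (simp add: strict_mono_less)
  moreover have "\<forall>i\<in>F. s (r 0) i \<le> s (r 1) i" using r(2) by (simp add: incseq_def)
  ultimately show ?thesis using that by blast
qed

section \<open>Minima and finite fibres of tuple sums\<close>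

lemma tuple_sum_mono:
  assumes "a \<in> arrays N" "p \<in> tuples N" "q \<in> tuples N" "\<forall>n\<in>{1..N}. p n \<le> q n"
  shows "tuple_sum N a p \<le> tuple_sum N a q"
  unfolding tuple_sum_def
proof (rule sum_mono)
  fix n assume n: "n \<in> {1..N}"
  then have "mono_on {1..} (a n)"
    using assms(1) by (auto simp: arrays_def intro: strict_mono_on_imp_mono_on)
  then show "a n (p n) \<le> a n (q n)"
    by (rule mono_onD) (use n assms in \<open>auto simp: tuples_def PiE_iff\<close>)
qed

lemma tuple_sum_strict_mono:
  assumes a: "a \<in> arrays N" and t: "p \<in> tuples N" "q \<in> tuples N"
    and le: "\<forall>n\<in>{1..N}. p n \<le> q n" and "p \<noteq> q"
  shows "tuple_sum N a p < tuple_sum N a q"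
proof -
  have str: "a n (p n) < a n (q n)" if "n \<in> {1..N}" "p n < q n" for n
    by (rule strict_mono_onD[of "{1..}"])
      (use a t that in \<open>auto simp: arrays_def tuples_def PiE_iff\<close>)
  have "\<exists>n\<in>{1..N}. p n \<noteq> q n"
    using t \<open>p \<noteq> q\<close> unfolding tuples_def by (meson PiE_ext)
  then obtain n where "n \<in> {1..N}" "p n < q n"
    using le by (auto simp: less_le)
  moreover have "a i (p i) \<le> a i (q i)" if "i \<in> {1..N}" for i
    using str[OF that] le that by (cases "p i = q i") (auto simp: less_le)
  ultimately show ?thesis
    unfolding tuple_sum_def by (intro sum_strict_mono_ex1) (auto intro!: str bexI[of _ n])
qed

text \<open>Otherwise dependent choice yields tuples with strictly decreasing sums; some earlier
  tuple lies componentwise below a later one, which contradicts monotonicity.\<close>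

lemma tuple_sum_attains_min:
  assumes a: "a \<in> arrays N" and Q: "Q \<subseteq> tuples N" "Q \<noteq> {}"
  shows "\<exists>p\<in>Q. \<forall>q\<in>Q. tuple_sum N a p \<le> tuple_sum N a q"
proof (rule ccontr)
  let ?R = "\<lambda>p q. q \<in> Q \<and> tuple_sum N a q < tuple_sum N a p"
  assume "\<not> ?thesis"
  then have next_ex: "\<exists>q. ?R p q" if "p \<in> Q" for p
    using that by (meson not_le)
  obtain p0 where "p0 \<in> Q" using Q(2) by blast
  obtain s :: "nat \<Rightarrow> nat \<Rightarrow> nat" where s: "\<And>n. s n \<in> Q" "\<And>n. ?R (s n) (s (Suc n))"
    using dependent_nat_choice[of "\<lambda>_ p. p \<in> Q" "\<lambda>_. ?R"] \<open>p0 \<in> Q\<close> next_ex by metis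
  obtain m n where mn: "m < n" "\<forall>i\<in>{1..N}. s m i \<le> s n i"
    using nat_tuple_seq_le[of "{1..N}" s] by blast
  have "tuple_sum N a (s n) < tuple_sum N a (s m)"
    using lift_Suc_mono_less[of "\<lambda>n. - tuple_sum N a (s n)" m n] s mn(1) by simp
  then show False
    using tuple_sum_mono[OF a _ _ mn(2)] s(1) Q(1) by fastforce
qed

text \<open>Distinct tuples of equal sum are incomparable by strict monotonicity, while infinitely
  many tuples contain a comparable pair.\<close>

lemma finite_tuple_sum_fibre:
  assumes a: "a \<in> arrays N"
  shows "finite {j \<in> tuples N. tuple_sum N a j = x}"
proof (rule ccontr)
  assume "infinite {j \<in> tuples N. tuple_sum N a j = x}"
  then obtain s :: "nat \<Rightarrow> nat \<Rightarrow> nat"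
    where s: "inj s" "range s \<subseteq> {j \<in> tuples N. tuple_sum N a j = x}"
    using infinite_countable_subset by blast
  obtain m n where mn: "m < n" "\<forall>i\<in>{1..N}. s m i \<le> s n i"
    using nat_tuple_seq_le[of "{1..N}" s] by blast
  have "s m \<noteq> s n" using s(1) mn(1) by (auto dest: injD)
  then have "tuple_sum N a (s m) < tuple_sum N a (s n)"
    using tuple_sum_strict_mono[OF a _ _ mn(2)] s(2) by blast
  moreover have "tuple_sum N a (s i) = x" for i using s(2) by auto
  ultimately show False by simp
qed

section \<open>Existence of an ordered enumeration\<close>

lemma infinite_tuples:
  assumes "N \<ge> 1"
  shows "infinite (tuples N)"
proof
  assume "finite (tuples N)"
  moreover have "(\<lambda>i. \<lambda>n\<in>{1..N}. i) ` {1..} \<subseteq> tuples N"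
    by (auto simp: tuples_def)
  moreover have "inj_on (\<lambda>i. \<lambda>n\<in>{1..N}. i) {1::nat..}"
    using assms by (intro inj_onI) (metis atLeastAtMost_iff order_refl restrict_apply')
  ultimately have "finite {1::nat..}"
    using inj_on_finite by blast
  then show False by (simp add: infinite_Ici)
qed

text \<open>Greedy enumeration: repeatedly remove a tuple of least sum among those left. With
  bounded rows some tuples may never be removed, so \<open>range g\<close> can be a proper subset of
  \<open>?T\<close>.\<close>

lemma ordered_spectrum_exists:
  assumes a: "a \<in> arrays N" and N: "N \<ge> 1"
  shows "\<exists>l. ordered_spectrum N a l"
proof -
  let ?f = "tuple_sum N a" and ?T = "tuples N"
  define pick where
    "pick Q = (SOME p. p \<in> Q \<and> (\<forall>q\<in>Q. ?f p \<le> ?f q))" for Q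
  have pick: "pick Q \<in> Q \<and> (\<forall>q\<in>Q. ?f (pick Q) \<le> ?f q)" if "Q \<subseteq> ?T" "Q \<noteq> {}" for Q
    using someI_ex[OF tuple_sum_attains_min[OF a that, unfolded Bex_def]] unfolding pick_def .
  \<comment> \<open>The recursion runs over the set of tuples already taken, since each choice
    depends on all earlier ones.\<close>
  define used where "used = rec_nat {} (\<lambda>_ U. insert (pick (?T - U)) U)"
  define g where "g n = pick (?T - used n)" for n
  have used_Suc: "used (Suc n) = insert (g n) (used n)" for n
    by (simp add: used_def g_def)
  have used: "used n = g ` {..<n}" for n
    by (induction n) (simp_all add: used_Suc lessThan_Suc, simp add: used_def)
  have g_eq: "g n = pick (?T - g ` {..<n})" for n
    using g_def[of n] by (simp only: used)
  have "?T - g ` {..<n} \<noteq> {}" for n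
    using infinite_tuples[OF N] by (metis finite.emptyI finite_Diff2 finite_imageI finite_lessThan)
  then have g: "g n \<in> ?T - g ` {..<n}" "\<And>q. q \<in> ?T - g ` {..<n} \<Longrightarrow> ?f (g n) \<le> ?f q" for n
    using pick[of "?T - g ` {..<n}", folded g_eq] by blast+
  have inj: "inj g"
  proof (rule linorder_injI)
    fix m n :: nat assume "m < n"
    then show "g m \<noteq> g n" using g(1)[of n] by (metis DiffE imageI lessThan_iff)
  qed
  have g_mono: "?f (g m) \<le> ?f (g n)" if "m \<le> n" for m n
    by (rule g(2)) (use g(1)[of n] that in auto)
  \<comment> \<open>A tuple that is never taken is a candidate at every stage, so no chosen sum
    exceeds its sum.\<close>
  have unlisted: "?f (g n) \<le> ?f t" if "t \<in> ?T" "t \<notin> range g" for t n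
    by (rule g(2)) (use that in auto)
  \<comment> \<open>\<open>g\<close> counts from 0, the listing from 1.\<close>
  define l where "l k = ?f (g (k - 1))" for k
  have listed: "t \<in> range g" if t: "t \<in> ?T" "?f t = ?f (g n)" for t n
  proof (rule ccontr)
    assume "t \<notin> range g"
    \<comment> \<open>From stage \<open>n\<close> on, the chosen sums are squeezed between
      \<open>?f (g n)\<close> and the equal value \<open>?f t\<close>, which would make a fibre
      infinite.\<close>
    then have "?f (g i) = ?f t" if "n \<le> i" for i
      using g_mono[OF that] unlisted[of t i] t by simp
    then have "g ` {n..} \<subseteq> {j \<in> ?T. ?f j = ?f t}" using g(1) by auto
    then have "finite (g ` {n..})"
      using finite_tuple_sum_fibre[OF a] finite_subset by blast
    then show False
      using inj finite_image_iff[of g "{n..}"] by (auto simp: infinite_Ici inj_on_def)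
  qed
  have "card {i. i \<ge> 1 \<and> l i = l k} = multiplicity_of N a (l k)" if "k \<ge> 1" for k
  proof -
    have "bij_betw (\<lambda>i. g (i - 1)) {i. i \<ge> 1 \<and> l i = l k} {j \<in> ?T. ?f j = l k}"
      unfolding bij_betw_def
    proof (intro conjI)
      show "inj_on (\<lambda>i. g (i - 1)) {i. i \<ge> 1 \<and> l i = l k}"
        by (auto intro!: inj_onI dest!: injD[OF inj])
      show "(\<lambda>i. g (i - 1)) ` {i. i \<ge> 1 \<and> l i = l k} = {j \<in> ?T. ?f j = l k}"
      proof (intro equalityI subsetI)
        fix t assume t: "t \<in> {j \<in> ?T. ?f j = l k}"
        then obtain n where "t = g n" using listed[of t "k - 1"] by (auto simp: l_def)
        then show "t \<in> (\<lambda>i. g (i - 1)) ` {i. i \<ge> 1 \<and> l i = l k}"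
          using t by (intro image_eqI[of _ _ "Suc n"]) (auto simp: l_def)
      qed (use g(1) in \<open>auto simp: l_def\<close>)
    qed
    then show ?thesis
      unfolding multiplicity_of_def by (rule bij_betw_same_card)
  qed
  moreover have "mono_on {1..} l"
    by (intro mono_onI) (auto simp: l_def intro!: g_mono)
  moreover have "l k \<in> spectrum N a" for k
    using g(1) by (auto simp: l_def spectrum_def)
  moreover have "(\<exists>k\<ge>1. l k = x) \<or> (\<forall>k\<ge>1. l k < x)" if x: "x \<in> spectrum N a" for x
  proof -
    obtain t where t: "t \<in> ?T" "x = ?f t" using x by (auto simp: spectrum_def)
    show ?thesis
    proof (cases "t \<in> range g")
      case True
      then obtain n where "t = g n" by blast
      then show ?thesis using t by (intro disjI1 exI[of _ "Suc n"]) (simp add: l_def)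
    next
      case False
      then show ?thesis
        using unlisted[OF t(1)] t(2) by (auto simp: l_def less_le)
    qed
  qed
  ultimately have "ordered_spectrum N a l"
    by (simp add: ordered_spectrum_def)
  then show ?thesis by blast
qed

section \<open>The k-th element characterised by counting\<close>

text \<open>Counting tuples avoids any reference to a listing, so values coming from different
  listings can be compared.\<close>

definition has_rank :: "nat \<Rightarrow> (nat \<Rightarrow> nat \<Rightarrow> real) \<Rightarrow> nat \<Rightarrow> real \<Rightarrow> bool" where
  "has_rank N a k x \<longleftrightarrow> x \<in> spectrum N a \<and> finite {j \<in> tuples N. tuple_sum N a j \<le> x} \<and>
     card {j \<in> tuples N. tuple_sum N a j < x} < k \<and> k \<le> card {j \<in> tuples N. tuple_sum N a j \<le> x}"

text \<open>If \<open>x < y\<close>, every tuple of sum at most \<open>x\<close> lies strictly below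
  \<open>y\<close>, so \<open>k\<close> would be at most a number smaller than
  \<open>k\<close>.\<close>

lemma has_rank_unique:
  assumes "has_rank N a k x" "has_rank N a k y"
  shows "x = y"
proof -
  have "\<not> x < y" if "has_rank N a k x" "has_rank N a k y" for x y
  proof
    assume "x < y"
    have "finite {j \<in> tuples N. tuple_sum N a j < y}"
      using that(2) unfolding has_rank_def by (auto elim!: rev_finite_subset)
    then have "card {j \<in> tuples N. tuple_sum N a j \<le> x} \<le> card {j \<in> tuples N. tuple_sum N a j < y}"
      by (rule card_mono) (use \<open>x < y\<close> in auto)
    then show False using that by (simp add: has_rank_def)
  qed
  from this[of x y] this[of y x] show ?thesis using assms by simp
qed

text \<open>Counts of tuples are turned, value by value, into counts of indices, which monotonicity
  of \<open>l\<close> compares with \<open>k\<close>.\<close>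

lemma ordered_spectrum_has_rank:
  assumes a: "a \<in> arrays N" and l: "ordered_spectrum N a l" and k: "k \<ge> 1"
  shows "has_rank N a k (l k)"
proof -
  let ?f = "tuple_sum N a" and ?T = "tuples N"
  have mono: "l i \<le> l j" if "1 \<le> i" "i \<le> j" for i j
    using l that by (auto simp: ordered_spectrum_def intro: mono_onD)
  have fibre: "card {i. i \<ge> 1 \<and> l i = l j} = card {t \<in> ?T. ?f t = l j}"
    and spec: "l j \<in> spectrum N a" if "j \<ge> 1" for j
    using l that by (auto simp: ordered_spectrum_def multiplicity_of_def)
  have finT: "finite {t \<in> ?T. ?f t = x}" for x
    by (rule finite_tuple_sum_fibre[OF a])
  \<comment> \<open>Only cardinalities are equated, and \<open>card\<close> of an infinite set is 0.
    The value is attained, so its count is positive and the index set is finite.\<close>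
  have finI: "finite {i. i \<ge> 1 \<and> l i = l j}" if "j \<ge> 1" for j
  proof -
    have "{t \<in> ?T. ?f t = l j} \<noteq> {}" using spec[OF that] by (auto simp: spectrum_def)
    then have "card {t \<in> ?T. ?f t = l j} > 0" using finT by (simp add: card_gt_0_iff)
    then show ?thesis using fibre[OF that] by (simp add: card_ge_0_finite)
  qed
  \<comment> \<open>An unlisted value would exceed every listed one, in particular
    \<open>l k\<close>.\<close>
  have below: "x \<in> l ` {1..}" if "x \<in> spectrum N a" "x \<le> l k" for x
    using l that k unfolding ordered_spectrum_def by (fastforce simp: image_iff)
  have count: "finite {t \<in> ?T. ?f t \<in> V} \<and> card {t \<in> ?T. ?f t \<in> V} = card {i. i \<ge> 1 \<and> l i \<in> V}"
    if V: "finite V" "V \<subseteq> l ` {1..}" for V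
  proof -
    have "{t \<in> ?T. ?f t \<in> V} = (\<Union>v\<in>V. {t \<in> ?T. ?f t = v})" by auto
    moreover have "card (\<Union>v\<in>V. {t \<in> ?T. ?f t = v}) = (\<Sum>v\<in>V. card {t \<in> ?T. ?f t = v})"
      using V finT by (intro card_UN_disjoint) auto
    moreover have "{i. i \<ge> 1 \<and> l i \<in> V} = (\<Union>v\<in>V. {i. i \<ge> 1 \<and> l i = v})" by auto
    moreover have "card (\<Union>v\<in>V. {i. i \<ge> 1 \<and> l i = v}) = (\<Sum>v\<in>V. card {i. i \<ge> 1 \<and> l i = v})"
      using V finI by (intro card_UN_disjoint) auto
    moreover have "(\<Sum>v\<in>V. card {t \<in> ?T. ?f t = v}) = (\<Sum>v\<in>V. card {i. i \<ge> 1 \<and> l i = v})"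
      using V fibre by (intro sum.cong) auto
    ultimately show ?thesis using V finT by simp
  qed
  \<comment> \<open>Beyond position \<open>k\<close>, monotonicity leaves only repetitions of
    \<open>l k\<close>.\<close>
  have "{i. i \<ge> 1 \<and> l i \<le> l k} \<subseteq> {1..k} \<union> {i. i \<ge> 1 \<and> l i = l k}"
    using mono k by (smt (verit, best) Un_iff atLeastAtMost_iff mem_Collect_eq nle_le subsetI)
  then have fin: "finite {i. i \<ge> 1 \<and> l i \<le> l k}"
    using finI[OF k] finite_subset by blast
  define W where "W = l ` {i. i \<ge> 1 \<and> l i \<le> l k}"
  define V where "V = l ` {i. i \<ge> 1 \<and> l i < l k}"
  have "finite V" "finite W"
    using fin unfolding V_def W_def by (auto intro!: finite_imageI elim!: rev_finite_subset)
  then have cV: "card {t \<in> ?T. ?f t \<in> V} = card {i. i \<ge> 1 \<and> l i \<in> V}"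
    and cW: "finite {t \<in> ?T. ?f t \<in> W}" "card {t \<in> ?T. ?f t \<in> W} = card {i. i \<ge> 1 \<and> l i \<in> W}"
    using count[of V] count[of W] by (auto simp: V_def W_def)
  have "?f t \<in> V \<longleftrightarrow> ?f t < l k" "?f t \<in> W \<longleftrightarrow> ?f t \<le> l k" if "t \<in> ?T" for t
    using below[of "?f t"] that by (auto simp: V_def W_def spectrum_def)
  then have eT: "{t \<in> ?T. ?f t \<in> V} = {t \<in> ?T. ?f t < l k}"
      "{t \<in> ?T. ?f t \<in> W} = {t \<in> ?T. ?f t \<le> l k}"
    by auto
  have eI: "{i. i \<ge> 1 \<and> l i \<in> V} = {i. i \<ge> 1 \<and> l i < l k}"
      "{i. i \<ge> 1 \<and> l i \<in> W} = {i. i \<ge> 1 \<and> l i \<le> l k}"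
    by (auto simp: V_def W_def)
  have "{i. i \<ge> 1 \<and> l i < l k} \<subseteq> {1..<k}"
    using mono[of k] k by (auto simp: not_le[symmetric])
  then have "card {i. i \<ge> 1 \<and> l i < l k} \<le> card {1..<k}"
    by (intro card_mono) auto
  then have "card {i. i \<ge> 1 \<and> l i < l k} < k"
    using k by simp
  moreover have "{1..k} \<subseteq> {i. i \<ge> 1 \<and> l i \<le> l k}"
    using mono by auto
  then have "k \<le> card {i. i \<ge> 1 \<and> l i \<le> l k}"
    using card_mono[OF fin, of "{1..k}"] by simp
  ultimately show ?thesis
    using cV cW spec[OF k] unfolding has_rank_def eT eI by simp
qed

text \<open>Justifies the \<open>THE\<close> in \<open>eigenvalue\<close>: a listing exists, and
  although \<open>l 0\<close> is arbitrary, the rank fixes the value at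
  \<open>k \<ge> 1\<close>.\<close>

lemma eigenvalue_has_rank:
  assumes a: "a \<in> arrays N" and "N \<ge> 1" and k: "k \<ge> 1"
  shows "has_rank N a k (eigenvalue N a k)"
proof -
  obtain l where l: "ordered_spectrum N a l"
    using ordered_spectrum_exists assms by blast
  have "eigenvalue N a k = l k"
    unfolding eigenvalue_def
    using l ordered_spectrum_has_rank[OF a _ k] has_rank_unique by (intro the_equality) blast+
  then show ?thesis using ordered_spectrum_has_rank[OF a l k] by simp
qed

section \<open>Two rows: the upper bound on multiplicities\<close>

lemma tuple_sum_2: "tuple_sum 2 a j = a 1 (j 1) + a 2 (j 2)"
  by (simp add: tuple_sum_def numeral_2_eq_2)

text \<open>The restriction to \<open>{1..2}\<close> places the pair in the extensional function
  space \<open>tuples 2\<close>.\<close>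

definition pair_tuple :: "nat \<Rightarrow> nat \<Rightarrow> nat \<Rightarrow> nat" where
  "pair_tuple i j = (\<lambda>n\<in>{1..2}. if n = 1 then i else j)"

lemma pair_tuple_simps [simp]: "pair_tuple i j (Suc 0) = i" "pair_tuple i j 2 = j"
  by (auto simp: pair_tuple_def)

lemma pair_tuple_in_tuples: "i \<ge> 1 \<Longrightarrow> j \<ge> 1 \<Longrightarrow> pair_tuple i j \<in> tuples 2"
  by (auto simp: pair_tuple_def tuples_def)

lemma tuples_2_pos: "p \<in> tuples 2 \<Longrightarrow> p 1 \<ge> 1 \<and> p 2 \<ge> 1"
  by (auto simp: tuples_def PiE_iff)

lemma tuples_2_ext:
  assumes "p \<in> tuples 2" "q \<in> tuples 2" "p 1 = q 1" "p 2 = q 2"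
  shows "p = q"
proof (rule PiE_ext[OF assms(1,2)[unfolded tuples_def]])
  fix n :: nat assume "n \<in> {1..2}"
  then have "n = 1 \<or> n = 2" by auto
  then show "p n = q n" using assms by auto
qed

text \<open>The square \<open>A \<times> A\<close> splits into the diagonal, \<open>?L\<close> and
  the converse of \<open>?L\<close>, the last two being of equal size.\<close>

lemma card_strict_pairs:
  fixes g :: "'a \<Rightarrow> nat"
  assumes "finite A" "inj_on g A"
  shows "2 * card {(p, q) \<in> A \<times> A. g p < g q} = card A * (card A - 1)"
proof -
  let ?L = "{(p, q) \<in> A \<times> A. g p < g q}"
  have fin: "finite ?L"
    using assms(1) by (auto intro: finite_subset[of _ "A \<times> A"])
  have split: "A \<times> A = Id_on A \<union> (?L \<union> ?L\<inverse>)"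
    using assms(2) by (auto simp: inj_on_def Id_on_def)
  have "card A * card A = card (Id_on A \<union> (?L \<union> ?L\<inverse>))"
    using arg_cong[OF split, of card] by (simp only: card_cartesian_product)
  also have "\<dots> = card (Id_on A) + card (?L \<union> ?L\<inverse>)"
    using fin assms(1) by (intro card_Un_disjoint) (auto simp: Id_on_def)
  also have "card (?L \<union> ?L\<inverse>) = card ?L + card (?L\<inverse>)"
    using fin by (intro card_Un_disjoint) auto
  also have "card (Id_on A) = card A"
    by (rule bij_betw_same_card[of fst]) (force simp: bij_betw_def inj_on_def Id_on_def)
  finally have "card A * card A = card A + 2 * card ?L"
    by (simp add: card_inverse)
  then show ?thesis by (cases "card A") simp_all
qed

lemma multiplicity_bound:
  assumes a: "a \<in> arrays 2" and fin: "finite {j \<in> tuples 2. tuple_sum 2 a j < x}"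
  shows "multiplicity_of 2 a x * (multiplicity_of 2 a x - 1)
    \<le> 2 * card {j \<in> tuples 2. tuple_sum 2 a j < x}"
proof -
  define A where "A = {j \<in> tuples 2. tuple_sum 2 a j = x}"
  have finA: "finite A" unfolding A_def by (rule finite_tuple_sum_fibre[OF a])
  have mono: "strict_mono_on {1..} (a 1)" "strict_mono_on {1..} (a 2)"
    using a by (auto simp: arrays_def)
  have inj: "inj_on (a 1) {1..}" "inj_on (a 2) {1..}"
    using mono strict_mono_on_imp_inj_on by auto
  have A: "p \<in> tuples 2" "p 1 \<in> {1..}" "p 2 \<in> {1..}" "a 1 (p 1) + a 2 (p 2) = x" if "p \<in> A" for p
    using that tuples_2_pos by (auto simp: A_def tuple_sum_2)
  \<comment> \<open>With the total fixed, either coordinate determines the other, as both rows are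
    injective.\<close>
  have iff: "p 1 = q 1 \<longleftrightarrow> p = q" "p 2 = q 2 \<longleftrightarrow> p = q" if "p \<in> A" "q \<in> A" for p q
    using A[OF that(1)] A[OF that(2)] inj tuples_2_ext[of p q]
    by (smt (verit) inj_on_eq_iff)+
  let ?L = "{(p, q) \<in> A \<times> A. p 1 < q 1}"
  have "card ?L \<le> card {j \<in> tuples 2. tuple_sum 2 a j < x}"
  proof (rule card_inj_on_le[OF _ _ fin])
    \<comment> \<open>\<open>p 1\<close> determines \<open>p\<close> and \<open>q 2\<close>
      determines \<open>q\<close>, so the mixed pair recovers both.\<close>
    show "inj_on (\<lambda>(p, q). pair_tuple (p 1) (q 2)) ?L"
    proof (rule inj_onI, clarify)
      fix p q p' q'
      assume mem: "p \<in> A" "q \<in> A" "p' \<in> A" "q' \<in> A"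
        and eq: "pair_tuple (p 1) (q 2) = pair_tuple (p' 1) (q' 2)"
      have "p 1 = p' 1" "q 2 = q' 2"
        using fun_cong[OF eq, of 1] fun_cong[OF eq, of 2] by simp_all
      then show "p = p' \<and> q = q'" using iff mem by blast
    qed
    show "(\<lambda>(p, q). pair_tuple (p 1) (q 2)) ` ?L \<subseteq> {j \<in> tuples 2. tuple_sum 2 a j < x}"
    proof clarify
      fix p q assume pq: "p \<in> A" "q \<in> A" "p 1 < q 1"
      then have "a 1 (p 1) < a 1 (q 1)"
        using A mono(1) by (blast intro: strict_mono_onD)
      then show "pair_tuple (p 1) (q 2) \<in> tuples 2 \<and> tuple_sum 2 a (pair_tuple (p 1) (q 2)) < x"
        using A[OF pq(1)] A[OF pq(2)] by (auto simp: tuple_sum_2 intro: pair_tuple_in_tuples)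
    qed
  qed
  moreover have "2 * card ?L = card A * (card A - 1)"
    using finA iff by (intro card_strict_pairs) (auto simp: inj_on_def)
  ultimately show ?thesis
    by (simp add: multiplicity_of_def A_def)
qed

section \<open>The extremal array\<close>

text \<open>Passing to the partial sums \<open>j 1 < j 1 + j 2\<close> turns such a tuple into a
  strictly ordered pair from \<open>{1..n}\<close>.\<close>

lemma card_tuples_2_sum_le: "2 * card {j \<in> tuples 2. j 1 + j 2 \<le> n} = n * (n - 1)"
proof -
  have "bij_betw (\<lambda>j. (j 1, j 1 + j 2)) {j \<in> tuples 2. j 1 + j 2 \<le> n}
      {(u, v) \<in> {1..n} \<times> {1..n}. u < v}"
    unfolding bij_betw_def
  proof (intro conjI)
    show "inj_on (\<lambda>j. (j 1, j 1 + j 2)) {j \<in> tuples 2. j 1 + j 2 \<le> n}"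
      by (auto simp: inj_on_def intro: tuples_2_ext)
    show "(\<lambda>j. (j 1, j 1 + j 2)) ` {j \<in> tuples 2. j 1 + j 2 \<le> n}
      = {(u, v) \<in> {1..n} \<times> {1..n}. u < v}"
    proof (intro equalityI subsetI)
      fix z assume "z \<in> {(u, v) \<in> {1..n} \<times> {1..n}. u < v}"
      then obtain u v where "z = (u, v)" "1 \<le> u" "u < v" "v \<le> n" by auto
      then show "z \<in> (\<lambda>j. (j 1, j 1 + j 2)) ` {j \<in> tuples 2. j 1 + j 2 \<le> n}"
        by (intro image_eqI[of _ _ "pair_tuple u (v - u)"]) (auto intro: pair_tuple_in_tuples)
    qed (use tuples_2_pos in force)
  qed
  then have "card {j \<in> tuples 2. j 1 + j 2 \<le> n} = card {(u, v) \<in> {1..n} \<times> {1..n}. u < v}"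
    by (rule bij_betw_same_card)
  then show ?thesis using card_strict_pairs[of "{1..n}" id] by simp
qed

text \<open>Here the sum \<open>m + 1\<close> is attained by exactly \<open>m\<close> pairs, and the
  hypotheses place \<open>k\<close> among its positions
  \<open>m (m - 1) / 2 + 1, ..., m (m + 1) / 2\<close>.\<close>

lemma mult_at_identity_array:
  assumes k: "m * (m - 1) < 2 * k" "2 * k \<le> (m + 1) * m"
  shows "mult_at 2 k (\<lambda>_. real) = m"
proof -
  define a :: "nat \<Rightarrow> nat \<Rightarrow> real" where "a = (\<lambda>_. real)"
  have a: "a \<in> arrays 2" by (auto simp: arrays_def a_def strict_mono_on_def)
  have sum: "tuple_sum 2 a j = real (j 1 + j 2)" for j
    by (simp add: tuple_sum_2 a_def)
  have "k \<ge> 1" using k(1) by (cases k) auto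
  then have rank: "has_rank 2 a k (eigenvalue 2 a k)"
    using eigenvalue_has_rank[OF a] by simp
  then obtain j where "eigenvalue 2 a k = tuple_sum 2 a j"
    unfolding has_rank_def spectrum_def by blast
  then obtain s :: nat where s: "eigenvalue 2 a k = real s"
    using that[of "j 1 + j 2"] sum[of j] by simp
  have "k \<le> card {j \<in> tuples 2. j 1 + j 2 \<le> s}"
    using rank unfolding s has_rank_def sum of_nat_le_iff by blast
  then have "2 * k \<le> s * (s - 1)"
    using card_tuples_2_sum_le[of s] by linarith
  then have "s \<noteq> 0" using \<open>k \<ge> 1\<close> by (cases s) auto
  \<comment> \<open>Sums are integers, so lying below \<open>s\<close> means being at most
    \<open>t\<close>; \<open>t\<close> will also be the multiplicity of \<open>s\<close>.\<close>
  then obtain t where t: "s = Suc t" by (cases s) auto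
  have le: "{j \<in> tuples 2. tuple_sum 2 a j \<le> real s} = {j \<in> tuples 2. j 1 + j 2 \<le> s}"
    and less: "{j \<in> tuples 2. tuple_sum 2 a j < real s} = {j \<in> tuples 2. j 1 + j 2 \<le> t}"
    unfolding sum of_nat_le_iff of_nat_less_iff t less_Suc_eq_le by simp_all
  have fin: "finite {j \<in> tuples 2. j 1 + j 2 \<le> s}"
    using rank by (simp add: has_rank_def s le)
  have "t * (t - 1) < 2 * k" "2 * k \<le> Suc t * t"
    using rank card_tuples_2_sum_le[of s] card_tuples_2_sum_le[of t]
    unfolding s has_rank_def le less by (auto simp: t)
  \<comment> \<open>The intervals from \<open>u * (u - 1)\<close> (exclusive) to
    \<open>Suc u * u\<close> (inclusive) are disjoint for distinct \<open>u\<close>, so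
    \<open>2 * k\<close> determines \<open>t\<close>.\<close>
  moreover have "Suc u * u \<le> v * (v - 1)" if "u < v" for u v :: nat
    using that by (intro mult_mono) auto
  ultimately have "t = m"
    using k by (metis Suc_eq_plus1 leD le_less_trans linorder_neqE_nat order_trans)
  \<comment> \<open>The multiplicity of \<open>s\<close> is the difference of two consecutive
    triangular counts, namely \<open>t\<close>.\<close>
  have "{j \<in> tuples 2. j 1 + j 2 \<le> s}
      = {j \<in> tuples 2. j 1 + j 2 \<le> t} \<union> {j \<in> tuples 2. tuple_sum 2 a j = real s}"
    unfolding sum of_nat_eq_iff t by auto
  moreover have "card ({j \<in> tuples 2. j 1 + j 2 \<le> t} \<union> {j \<in> tuples 2. tuple_sum 2 a j = real s})
      = card {j \<in> tuples 2. j 1 + j 2 \<le> t} + multiplicity_of 2 a (real s)"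
    unfolding multiplicity_of_def
  proof (rule card_Un_disjoint)
    show "finite {j \<in> tuples 2. j 1 + j 2 \<le> t}"
      by (rule finite_subset[OF _ fin]) (auto simp: t)
    show "{j \<in> tuples 2. j 1 + j 2 \<le> t} \<inter> {j \<in> tuples 2. tuple_sum 2 a j = real s} = {}"
      unfolding sum of_nat_eq_iff t by auto
  qed (rule finite_tuple_sum_fibre[OF a])
  ultimately have "Suc t * t = t * (t - 1) + 2 * multiplicity_of 2 a (real s)"
    using card_tuples_2_sum_le[of s] card_tuples_2_sum_le[of t] by (simp add: t)
  then have "multiplicity_of 2 a (real s) = t"
    by (cases t) auto
  then show ?thesis
    by (simp add: mult_at_def s \<open>t = m\<close> flip: a_def)
qed

section \<open>The floor formula and the conclusion\<close>

text \<open>The number under the floor is the larger root \<open>r\<close> of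
  \<open>r * (r - 1) = 2 * k - 2\<close>; comparing it with \<open>m\<close> and
  \<open>m + 1\<close> brackets \<open>2 * k - 2\<close>.\<close>

lemma floor_triangular_root:
  fixes k :: nat
  assumes "k \<ge> 1"
  defines "m \<equiv> nat \<lfloor>(1 / 2) * (1 + sqrt (8 * real k - 7))\<rfloor>"
  shows "m * (m - 1) < 2 * k" "2 * k \<le> (m + 1) * m"
proof -
  define r where "r = (1 / 2) * (1 + sqrt (8 * real k - 7))"
  have "sqrt (8 * real k - 7) \<ge> 1" using assms(1) by simp
  then have "r \<ge> 1" by (simp add: r_def)
  then have m: "real m \<le> r" "r < real m + 1" "m \<ge> 1"
    unfolding m_def r_def[symmetric] by (auto simp: le_nat_iff le_floor_iff)
  have "(sqrt (8 * real k - 7))\<^sup>2 = 8 * real k - 7" using assms(1) by simp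
  then have r: "r * (r - 1) = 2 * real k - 2"
    by (simp add: r_def field_simps power2_eq_square)
  have "real m * (real m - 1) \<le> r * (r - 1)"
    using m by (intro mult_mono) auto
  then have "real (m * (m - 1)) \<le> 2 * real k - 2"
    using m(3) r by (simp add: of_nat_diff)
  then have "real (m * (m - 1)) < real (2 * k)" by simp
  then show "m * (m - 1) < 2 * k" by (simp only: of_nat_less_iff)
  have "r * (r - 1) < (real m + 1) * real m"
    using m \<open>r \<ge> 1\<close> by (intro mult_strict_mono) auto
  then have "real (2 * k) < real ((m + 1) * m + 2)"
    using r by (simp add: algebra_simps)
  then have "2 * k < (m + 1) * m + 2" by (simp only: of_nat_less_iff)
  \<comment> \<open>The strict bound still allows \<open>2 * k = (m + 1) * m + 1\<close>; parity
    excludes this.\<close>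
  moreover have "even ((m + 1) * m)" by simp
  ultimately show "2 * k \<le> (m + 1) * m" by presburger
qed

theorem theorem6p1:
  fixes k :: nat
  assumes "k \<ge> 1"
  shows "max_mult 2 k = enat (nat \<lfloor>(1 / 2) * (1 + sqrt (8 * real k - 7))\<rfloor>)"
proof -
  define m where "m = nat \<lfloor>(1 / 2) * (1 + sqrt (8 * real k - 7))\<rfloor>"
  have k: "m * (m - 1) < 2 * k" "2 * k \<le> (m + 1) * m"
    using floor_triangular_root[OF assms] by (simp_all add: m_def)
  have bound: "mult_at 2 k a \<le> m" if a: "a \<in> arrays 2" for a
  proof (rule ccontr)
    define M where "M = mult_at 2 k a"
    let ?x = "eigenvalue 2 a k"
    assume "\<not> mult_at 2 k a \<le> m"
    \<comment> \<open>From \<open>M \<ge> m + 1\<close> follows the cycle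
      \<open>(m + 1) * m \<le> M * (M - 1) < 2 * k \<le> (m + 1) * m\<close>.\<close>
    then have "(m + 1) * m \<le> M * (M - 1)"
      unfolding M_def by (intro mult_mono) auto
    moreover have rank: "has_rank 2 a k ?x"
      using eigenvalue_has_rank[OF a _ assms] by simp
    then have "finite {j \<in> tuples 2. tuple_sum 2 a j < ?x}"
      unfolding has_rank_def by (auto elim!: rev_finite_subset)
    then have "M * (M - 1) \<le> 2 * card {j \<in> tuples 2. tuple_sum 2 a j < ?x}"
      unfolding M_def mult_at_def by (rule multiplicity_bound[OF a])
    moreover have "card {j \<in> tuples 2. tuple_sum 2 a j < ?x} < k"
      using rank by (simp add: has_rank_def)
    ultimately show False using k(2) by linarith
  qed
  have "max_mult 2 k = enat m"
    unfolding max_mult_def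
  proof (rule antisym)
    show "(SUP a\<in>arrays 2. enat (mult_at 2 k a)) \<le> enat m"
      using bound by (intro SUP_least) simp
    have "(\<lambda>_. real) \<in> arrays 2"
      by (auto simp: arrays_def strict_mono_on_def)
    then show "enat m \<le> (SUP a\<in>arrays 2. enat (mult_at 2 k a))"
      by (rule SUP_upper2) (simp add: mult_at_identity_array[OF k])
  qed
  then show ?thesis by (simp add: m_def)
qed

end
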